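(* Let $G=(V,E,\Omega)$, $V=\{1,\dots,N\}$, be a finite, connected, undirected, simple weighted graph, let $\tau>0$, and let $\rho^m=(\rho_i^m)_{i\in V}$ ($1\le m\le M+1$) and skew-symmetric edge velocities $v^m=(v^m_{i,j})_{(i,j)\in E}$ satisfy the discrete continuity equation (U) with the upwind weight $\theta^{\mathrm{up}}$ (see context). Assume $\rho^1\ge0$ componentwise. Put $(v_{i,j}^m)^+:=\max(v_{i,j}^m,0)$ and $(v_{i,j}^m)^-:=\max(-v_{i,j}^m,0)$, so that $v^m_{i,j}=(v^m_{i,j})^+-(v^m_{i,j})^-$. If, for all nodes $i\in V$ and all time levels $m$, $$\tau\sum_{j\in\mathcal N(i)}\sqrt{\omega_{ij}}\,(v_{i,j}^m)^+\le1,$$ then the density update is nonnegativity-preserving: for $m=1,\dots,M$, if $\rho^m\ge0$ componentwise, then $\rho^{m+1}\ge0$ componentwise. In particular, letting $d_{\max}:=\max_{i\in V}|\mathcal N(i)|$, $\omega_{\max}:=\max_{(i,j)\in E}\omega_{ij}$ and $\|v^m\|_\infty:=\max_{(i,j)\in E}|v_{i,j}^m|$, a sufficient global condition (for the inequality $\tau\sum_{j\in\mathcal N(i)}\sqrt{\omega_{ij}}\,(v_{i,j}^m)^+\le1$ to hold for all $i\in V$ and all $m$) is $$\tau\le\frac{1}{d_{\max}\sqrt{\omega_{\max}}\,\|v^m\|_\infty}\qquad\text{for all } m.$$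
   Context: $\Omega=(\omega_{ij})$ is a symmetric matrix with $\omega_{ij}=\omega_{ji}>0$ if $(i,j)\in E$ and $\omega_{ij}=0$ otherwise; $\mathcal N(i)=\{j:(i,j)\in E\}$ is the set of neighbours of $i$. Skew-symmetric means $v^m_{j,i}=-v^m_{i,j}$. Upwind weight: $$\theta_{ij}^{\mathrm{up}}(\rho^m,v^m)=\begin{cases}\rho_i^m,& v_{i,j}^m\ge0,\\ \rho_j^m,& v_{i,j}^m<0.\end{cases}$$ Discrete continuity equation (U): for $m=1,\dots,M$, $$\rho_i^{m+1}=\rho_i^m-\tau\sum_{j\in\mathcal N(i)}\sqrt{\omega_{ij}}\,v_{i,j}^m\,\theta^{\mathrm{up}}_{ij}(\rho^m,v^m),\qquad i\le N-1,$$ together with mass conservation $\sum_{i\in V}\rho_i^m=1$ for all $m$, which determines $\rho_N^m$. If $\|v^m\|_\infty=0$ the global condition is understood to impose no restriction at level $m$. *)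

theory Defs
  imports Complex_Main "Graph_Theory.Graph_Theory"
begin

text \<open>
  An undirected graph is a symmetric digraph: an undirected edge between i and j is present as
  both arcs \<open>(i, j)\<close> and \<open>(j, i)\<close>. The locale predicate \<open>pair_graph\<close> says finite, loop-free and
  symmetric; multiple edges are excluded by the representation. Only the values of the weights
  on vertices, and of the velocities on arcs, are ever used.
\<close>

definition weighted_graph ::
  "nat \<Rightarrow> nat pair_pre_digraph \<Rightarrow> (nat \<Rightarrow> nat \<Rightarrow> real) \<Rightarrow> bool" where
  "weighted_graph N G \<omega> \<longleftrightarrow>
     pair_graph G \<and> Digraph_Component.connected (with_proj G) \<and> pverts G = {1..N} \<and>
     (\<forall>i\<in>pverts G. \<forall>j\<in>pverts G.
        \<omega> i j = \<omega> j i \<and> (if (i, j) \<in> parcs G then \<omega> i j > 0 else \<omega> i j = 0))"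

definition neighbours :: "nat pair_pre_digraph \<Rightarrow> nat \<Rightarrow> nat set" where
  "neighbours G i = {j. (i, j) \<in> parcs G}"

definition skew_symmetric_on :: "nat rel \<Rightarrow> (nat \<Rightarrow> nat \<Rightarrow> real) \<Rightarrow> bool" where
  "skew_symmetric_on E u \<longleftrightarrow> (\<forall>(i, j)\<in>E. u j i = - u i j)"

definition upwind_weight ::
  "(nat \<Rightarrow> real) \<Rightarrow> (nat \<Rightarrow> nat \<Rightarrow> real) \<Rightarrow> nat \<Rightarrow> nat \<Rightarrow> real" where
  "upwind_weight r u i j = (if u i j \<ge> 0 then r i else r j)"

text \<open>
  The time level is the first argument of \<open>\<rho>\<close> and \<open>v\<close>. The update formula is imposed at the nodes
  other than \<open>N\<close>; the density at node \<open>N\<close> is fixed by mass conservation.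
\<close>

definition discrete_continuity_eq ::
  "nat \<Rightarrow> nat pair_pre_digraph \<Rightarrow> (nat \<Rightarrow> nat \<Rightarrow> real) \<Rightarrow> real \<Rightarrow> nat \<Rightarrow>
   (nat \<Rightarrow> nat \<Rightarrow> real) \<Rightarrow> (nat \<Rightarrow> nat \<Rightarrow> nat \<Rightarrow> real) \<Rightarrow> bool" where
  "discrete_continuity_eq N G \<omega> \<tau> M \<rho> v \<longleftrightarrow>
     (\<forall>m\<in>{1..M}. \<forall>i\<in>{1..<N}.
        \<rho> (m + 1) i = \<rho> m i - \<tau> * (\<Sum>j\<in>neighbours G i.
           sqrt (\<omega> i j) * v m i j * upwind_weight (\<rho> m) (v m) i j)) \<and>
     (\<forall>m\<in>{1..M + 1}. (\<Sum>i\<in>pverts G. \<rho> m i) = 1)"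

definition pos_part :: "real \<Rightarrow> real" where
  "pos_part x = max x 0"

definition max_degree :: "nat pair_pre_digraph \<Rightarrow> nat" where
  "max_degree G = Max ((\<lambda>i. card (neighbours G i)) ` pverts G)"

text \<open>
  The one-vertex graph has no edges. Maxima of nonnegative quantities over the empty edge set
  are then taken to be 0.
\<close>

definition max_weight :: "nat pair_pre_digraph \<Rightarrow> (nat \<Rightarrow> nat \<Rightarrow> real) \<Rightarrow> real" where
  "max_weight G \<omega> = (if parcs G = {} then 0 else Max ((\<lambda>(i, j). \<omega> i j) ` parcs G))"

definition velocity_norm :: "nat pair_pre_digraph \<Rightarrow> (nat \<Rightarrow> nat \<Rightarrow> real) \<Rightarrow> real" where
  "velocity_norm G u = (if parcs G = {} then 0 else Max ((\<lambda>(i, j). \<bar>u i j\<bar>) ` parcs G))"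

definition local_step_condition ::
  "nat pair_pre_digraph \<Rightarrow> (nat \<Rightarrow> nat \<Rightarrow> real) \<Rightarrow> real \<Rightarrow> (nat \<Rightarrow> nat \<Rightarrow> real) \<Rightarrow> nat \<Rightarrow> bool" where
  "local_step_condition G \<omega> \<tau> u i \<longleftrightarrow>
     \<tau> * (\<Sum>j\<in>neighbours G i. sqrt (\<omega> i j) * pos_part (u i j)) \<le> 1"

text \<open>
  The case of vanishing velocity is separated because Isabelle's \<open>1 / 0 = 0\<close> would turn the
  intended absence of a restriction into the unsatisfiable \<open>\<tau> \<le> 0\<close>.
\<close>

definition global_step_condition ::
  "nat pair_pre_digraph \<Rightarrow> (nat \<Rightarrow> nat \<Rightarrow> real) \<Rightarrow> real \<Rightarrow> (nat \<Rightarrow> nat \<Rightarrow> real) \<Rightarrow> bool" where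
  "global_step_condition G \<omega> \<tau> u \<longleftrightarrow>
     (velocity_norm G u \<noteq> 0 \<longrightarrow>
        \<tau> \<le> 1 / (real (max_degree G) * sqrt (max_weight G \<omega>) * velocity_norm G u))"

end

theory Submission
  imports Defs
begin

text \<open>
  The upwind flux is antisymmetric in its two nodes, so the fluxes cancel in the sum over all nodes
  and mass conservation turns the update formula at the other nodes into the same formula at
  node \<open>N\<close>. At a nonnegative density the flux from \<open>i\<close> to \<open>j\<close> is at most
  \<open>sqrt (\<omega> i j) * pos_part (u i j) * r i\<close>, whence the updated density at \<open>i\<close> is at least \<open>r i\<close> times
  a factor that the step condition makes nonnegative.
\<close>

definition flux ::
  "(nat \<Rightarrow> nat \<Rightarrow> real) \<Rightarrow> (nat \<Rightarrow> real) \<Rightarrow> (nat \<Rightarrow> nat \<Rightarrow> real) \<Rightarrow> nat \<Rightarrow> nat \<Rightarrow> real" where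
  "flux \<omega> r u i j = sqrt (\<omega> i j) * u i j * upwind_weight r u i j"

text \<open>For nonzero velocity, (i, j) and (j, i) pick the same upwind node, so only the sign
  changes. At velocity 0 they pick different nodes, but the velocity factor makes both fluxes
  vanish.\<close>

lemma flux_antisym:
  assumes "\<omega> j i = \<omega> i j" "u j i = - u i j"
  shows "flux \<omega> r u j i = - flux \<omega> r u i j"
  using assms by (cases "u i j = 0") (auto simp: flux_def upwind_weight_def)

lemma sum_sum_antisym:
  fixes f :: "'a \<Rightarrow> 'a \<Rightarrow> real"
  assumes "\<And>i j. i \<in> A \<Longrightarrow> j \<in> A \<Longrightarrow> f j i = - f i j"
  shows "(\<Sum>i\<in>A. \<Sum>j\<in>A. f i j) = 0"
proof -
  have "(\<Sum>i\<in>A. \<Sum>j\<in>A. f i j) = (\<Sum>i\<in>A. \<Sum>j\<in>A. f j i)"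
    by (rule sum.swap)
  also have "\<dots> = (\<Sum>i\<in>A. \<Sum>j\<in>A. - f i j)"
    by (intro sum.cong refl assms)
  also have "\<dots> = - (\<Sum>i\<in>A. \<Sum>j\<in>A. f i j)"
    by (simp add: sum_negf)
  finally show ?thesis by simp
qed

text \<open>For outflow (\<open>u i j \<ge> 0\<close>) this is an equality. For inflow the right
  side is 0 and the flux is at most 0, since the upwind density \<open>r j\<close> is
  nonnegative.\<close>

lemma flux_le:
  assumes "0 \<le> \<omega> i j" "0 \<le> r i" "0 \<le> r j"
  shows "flux \<omega> r u i j \<le> sqrt (\<omega> i j) * pos_part (u i j) * r i"
  using assms
  by (auto simp: flux_def upwind_weight_def pos_part_def max_def mult_le_0_iff zero_le_mult_iff)

lemma weighted_graphD:
  assumes "weighted_graph N G \<omega>"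
  shows weighted_graph_finite_arcs: "finite (parcs G)"
    and weighted_graph_verts: "pverts G = {1..N}"
    and weighted_graph_arc_verts: "(i, j) \<in> parcs G \<Longrightarrow> i \<in> pverts G \<and> j \<in> pverts G"
    and weighted_graph_arc_sym: "(i, j) \<in> parcs G \<Longrightarrow> (j, i) \<in> parcs G"
    and weighted_graph_weight_sym: "(i, j) \<in> parcs G \<Longrightarrow> \<omega> j i = \<omega> i j"
    and weighted_graph_weight_nonneg: "(i, j) \<in> parcs G \<Longrightarrow> 0 \<le> \<omega> i j"
proof -
  interpret pair_graph G
    using assms by (simp add: weighted_graph_def)
  show "finite (parcs G)" "pverts G = {1..N}"
    using assms by (simp_all add: weighted_graph_def)
  show verts: "i \<in> pverts G \<and> j \<in> pverts G" if "(i, j) \<in> parcs G"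
    using that by (auto dest: in_arcsD1 in_arcsD2)
  show "(j, i) \<in> parcs G" if "(i, j) \<in> parcs G"
    using that by (rule arcs_symmetric)
  have "\<omega> i j = \<omega> j i" "0 < \<omega> i j" if "(i, j) \<in> parcs G"
    using that assms verts[OF that] unfolding weighted_graph_def by metis+
  then show "\<omega> j i = \<omega> i j" "0 \<le> \<omega> i j" if "(i, j) \<in> parcs G"
    using that by (simp_all add: less_imp_le)
qed

lemma neighbours_subset_verts:
  assumes "weighted_graph N G \<omega>"
  shows "neighbours G i \<subseteq> pverts G"
  using weighted_graph_arc_verts[OF assms] by (auto simp: neighbours_def)

lemma sum_flux_eq_0:
  assumes G: "weighted_graph N G \<omega>" and u: "skew_symmetric_on (parcs G) u"
  shows "(\<Sum>i\<in>pverts G. \<Sum>j\<in>neighbours G i. flux \<omega> r u i j) = 0"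
proof -
  \<comment> \<open>Extending the flux by zero off the arcs gives all inner sums the same index set,
    as the exchange of the two summations requires.\<close>
  let ?f = "\<lambda>i j. if (i, j) \<in> parcs G then flux \<omega> r u i j else 0"
  have fin: "finite (pverts G)"
    using weighted_graph_verts[OF G] by simp
  have "(\<Sum>j\<in>neighbours G i. flux \<omega> r u i j) = (\<Sum>j\<in>pverts G. ?f i j)" for i
    using neighbours_subset_verts[OF G, of i] fin
    by (intro sum.mono_neutral_cong_left) (auto simp: neighbours_def)
  moreover have "(\<Sum>i\<in>pverts G. \<Sum>j\<in>pverts G. ?f i j) = 0"
  proof (rule sum_sum_antisym)
    show "?f j i = - ?f i j" for i j
    proof (cases "(i, j) \<in> parcs G")
      case True
      with u have "u j i = - u i j"
        by (auto simp: skew_symmetric_on_def)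
      with True show ?thesis
        using flux_antisym[of \<omega> j i u r] weighted_graph_weight_sym[OF G True]
          weighted_graph_arc_sym[OF G True]
        by presburger
    next
      case False
      then show ?thesis
        using weighted_graph_arc_sym[OF G] by auto
    qed
  qed
  ultimately show ?thesis by simp
qed

lemma discrete_continuity_eq_all_nodes:
  assumes G: "weighted_graph N G \<omega>" and u: "skew_symmetric_on (parcs G) (v m)"
    and U: "discrete_continuity_eq N G \<omega> \<tau> M \<rho> v"
    and m: "m \<in> {1..M}" and i: "i \<in> pverts G"
  shows "\<rho> (m + 1) i = \<rho> m i - \<tau> * (\<Sum>j\<in>neighbours G i. flux \<omega> (\<rho> m) (v m) i j)"
proof -
  let ?F = "\<lambda>i. \<Sum>j\<in>neighbours G i. flux \<omega> (\<rho> m) (v m) i j"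
  \<comment> \<open>\<open>?g\<close> is the residual of the update formula. It vanishes at every
    node below \<open>N\<close>, so its value at \<open>N\<close> equals its sum over all
    nodes.\<close>
  let ?g = "\<lambda>i. \<rho> (m + 1) i - \<rho> m i + \<tau> * ?F i"
  have "1 \<le> N"
    using i unfolding weighted_graph_verts[OF G] by simp
  then have V: "pverts G = insert N {1..<N}"
    unfolding weighted_graph_verts[OF G] by (intro set_eqI) (simp, linarith)
  have g0: "?g k = 0" if "k \<in> {1..<N}" for k
    using U m that by (simp add: discrete_continuity_eq_def flux_def)
  \<comment> \<open>Mass conservation runs up to level \<open>M + 1\<close>, hence it covers
    \<open>m + 1\<close> even for \<open>m = M\<close>.\<close>
  have "(\<Sum>k\<in>pverts G. \<rho> m k) = 1" "(\<Sum>k\<in>pverts G. \<rho> (m + 1) k) = 1"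
    using U m by (simp_all add: discrete_continuity_eq_def)
  moreover have "(\<Sum>k\<in>pverts G. \<tau> * ?F k) = 0"
    using sum_flux_eq_0[OF G u] by (simp only: mult_zero_right flip: sum_distrib_left)
  ultimately have "(\<Sum>k\<in>pverts G. ?g k) = 0"
    by (simp add: sum.distrib sum_subtractf)
  moreover have "(\<Sum>k\<in>pverts G. ?g k) = ?g N + (\<Sum>k\<in>{1..<N}. ?g k)"
    unfolding V by (rule sum.insert) auto
  moreover have "(\<Sum>k\<in>{1..<N}. ?g k) = 0"
    using g0 by (intro sum.neutral) blast
  ultimately have "?g N = 0" by linarith
  with g0 i have "?g i = 0" unfolding V by blast
  then show ?thesis by simp
qed

text \<open>In one step at most the fraction \<open>\<tau> * ?S \<le> 1\<close> of the density at
  \<open>i\<close> flows out, and inflow from nonnegative neighbours only adds to what is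
  left.\<close>

lemma upwind_update_nonneg:
  assumes G: "weighted_graph N G \<omega>" and \<tau>: "\<tau> > 0" and i: "i \<in> pverts G"
    and r: "\<And>k. k \<in> pverts G \<Longrightarrow> 0 \<le> r k"
    and loc: "local_step_condition G \<omega> \<tau> u i"
  shows "0 \<le> r i - \<tau> * (\<Sum>j\<in>neighbours G i. flux \<omega> r u i j)"
proof -
  let ?S = "\<Sum>j\<in>neighbours G i. sqrt (\<omega> i j) * pos_part (u i j)"
  have "(\<Sum>j\<in>neighbours G i. flux \<omega> r u i j) \<le>
      (\<Sum>j\<in>neighbours G i. sqrt (\<omega> i j) * pos_part (u i j) * r i)"
    using neighbours_subset_verts[OF G, of i] weighted_graph_weight_nonneg[OF G] r i
    by (intro sum_mono flux_le) (auto simp: neighbours_def)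
  also have "\<dots> = ?S * r i"
    by (simp add: sum_distrib_right)
  finally have "\<tau> * (\<Sum>j\<in>neighbours G i. flux \<omega> r u i j) \<le> \<tau> * ?S * r i"
    using \<tau> by (simp add: mult.assoc)
  also have "\<dots> \<le> 1 * r i"
    using loc r[OF i] by (intro mult_right_mono) (auto simp: local_step_condition_def)
  finally show ?thesis by simp
qed

text \<open>The local sum has at most \<open>max_degree G\<close> terms, each bounded by the root of
  the maximal weight times the velocity norm.\<close>

lemma local_step_condition_if_global:
  assumes G: "weighted_graph N G \<omega>" and \<tau>: "\<tau> > 0" and i: "i \<in> pverts G"
    and glob: "global_step_condition G \<omega> \<tau> u"
  shows "local_step_condition G \<omega> \<tau> u i"
proof -
  let ?d = "real (max_degree G)" and ?w = "max_weight G \<omega>" and ?c = "velocity_norm G u"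
  let ?S = "\<Sum>j\<in>neighbours G i. sqrt (\<omega> i j) * pos_part (u i j)"
  have fin: "finite (parcs G)" "finite (pverts G)"
    using weighted_graph_finite_arcs[OF G] weighted_graph_verts[OF G] by simp_all
  have w: "\<omega> i j \<le> ?w" and c: "\<bar>u i j\<bar> \<le> ?c" if "(i, j) \<in> parcs G" for j
    using that fin by (auto simp: max_weight_def velocity_norm_def intro!: Max_ge image_eqI[OF _ that])
  have "card (neighbours G i) \<le> max_degree G"
    using i fin by (auto simp: max_degree_def)
  then have d: "real (card (neighbours G i)) \<le> ?d" by simp
  show ?thesis
  \<comment> \<open>In the degenerate cases the local sum is 0: it is empty, or every velocity on an
    arc from \<open>i\<close> vanishes. The latter must be separate because the global condition
    then says nothing about \<open>\<tau>\<close>.\<close>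
  proof (cases "neighbours G i = {} \<or> ?c = 0")
    case True
    then have "\<tau> * ?S = 0"
      using c by (auto simp: neighbours_def pos_part_def intro!: sum.neutral)
    then show ?thesis unfolding local_step_condition_def by linarith
  next
    case False
    have edge: "sqrt (\<omega> i j) * pos_part (u i j) \<le> sqrt ?w * ?c" "0 \<le> sqrt ?w * ?c"
      if "j \<in> neighbours G i" for j
    proof -
      have a: "(i, j) \<in> parcs G"
        using that by (simp add: neighbours_def)
      have "0 \<le> ?w" "0 \<le> ?c"
        using w[OF a] c[OF a] weighted_graph_weight_nonneg[OF G a] by linarith+
      then show "sqrt (\<omega> i j) * pos_part (u i j) \<le> sqrt ?w * ?c" "0 \<le> sqrt ?w * ?c"
        using w[OF a] c[OF a] by (auto simp: pos_part_def intro!: mult_mono)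
    qed
    have "?S \<le> real (card (neighbours G i)) * (sqrt ?w * ?c)"
      using edge(1) by (rule sum_bounded_above)
    \<comment> \<open>\<open>False\<close> supplies a neighbour of \<open>i\<close>, and with it the
      sign of \<open>sqrt ?w * ?c\<close>.\<close>
    also have "\<dots> \<le> ?d * (sqrt ?w * ?c)"
      using d edge(2) False by (intro mult_right_mono) auto
    finally have S: "?S \<le> ?d * sqrt ?w * ?c"
      by (simp add: mult.assoc)
    have \<tau>_le: "\<tau> \<le> 1 / (?d * sqrt ?w * ?c)"
      using glob False by (simp add: global_step_condition_def)
    \<comment> \<open>Positivity of the denominator is read off from \<open>0 < \<tau>\<close>: a
      zero denominator would give quotient 0, a negative one a negative quotient. The division can
      then be cleared.\<close>
    with \<tau> have "0 < 1 / (?d * sqrt ?w * ?c)"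
      by (rule less_le_trans)
    then have "0 < ?d * sqrt ?w * ?c"
      by (simp only: zero_less_divide_1_iff)
    with \<tau>_le have "\<tau> * (?d * sqrt ?w * ?c) \<le> 1"
      by (simp only: pos_le_divide_eq)
    with mult_left_mono[OF S, of \<tau>] \<tau> show ?thesis
      unfolding local_step_condition_def by linarith
  qed
qed

theorem proposition3p4:
  fixes N M :: nat
    and G :: "nat pair_pre_digraph"
    and \<omega> :: "nat \<Rightarrow> nat \<Rightarrow> real"
    and \<tau> :: real
    and \<rho> :: "nat \<Rightarrow> nat \<Rightarrow> real"
    and v :: "nat \<Rightarrow> nat \<Rightarrow> nat \<Rightarrow> real"
  assumes "weighted_graph N G \<omega>"
    and "\<tau> > 0"
    and "\<forall>m\<in>{1..M}. skew_symmetric_on (parcs G) (v m)"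
    and "discrete_continuity_eq N G \<omega> \<tau> M \<rho> v"
    and "\<forall>i\<in>pverts G. \<rho> 1 i \<ge> 0"
  shows "((\<forall>m\<in>{1..M}. \<forall>i\<in>pverts G. local_step_condition G \<omega> \<tau> (v m) i) \<longrightarrow>
            (\<forall>m\<in>{1..M}. (\<forall>i\<in>pverts G. \<rho> m i \<ge> 0) \<longrightarrow> (\<forall>i\<in>pverts G. \<rho> (m + 1) i \<ge> 0))) \<and>
         ((\<forall>m\<in>{1..M}. global_step_condition G \<omega> \<tau> (v m)) \<longrightarrow>
            (\<forall>m\<in>{1..M}. \<forall>i\<in>pverts G. local_step_condition G \<omega> \<tau> (v m) i))"
proof (intro conjI impI ballI)
  fix m i
  assume loc: "\<forall>m\<in>{1..M}. \<forall>i\<in>pverts G. local_step_condition G \<omega> \<tau> (v m) i"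
    and m: "m \<in> {1..M}" and nonneg: "\<forall>i\<in>pverts G. \<rho> m i \<ge> 0" and i: "i \<in> pverts G"
  \<comment> \<open>The claim concerns a single time step; the formula valid at every node lets
    \<open>i = N\<close> be treated like the others.\<close>
  have "\<rho> (m + 1) i = \<rho> m i - \<tau> * (\<Sum>j\<in>neighbours G i. flux \<omega> (\<rho> m) (v m) i j)"
    using assms(1,3,4) m i by (intro discrete_continuity_eq_all_nodes) blast+
  also have "\<dots> \<ge> 0"
    using assms(1,2) i loc m nonneg by (intro upwind_update_nonneg) blast+
  finally show "\<rho> (m + 1) i \<ge> 0" .
next
  fix m i
  assume "\<forall>m\<in>{1..M}. global_step_condition G \<omega> \<tau> (v m)" "m \<in> {1..M}" "i \<in> pverts G"
  with assms(1,2) show "local_step_condition G \<omega> \<tau> (v m) i"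
    by (blast intro: local_step_condition_if_global)
qed

end
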